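(* Let $L$ be an integer matrix of size $s\times s$ with rows $\ell_1,\ldots,\ell_s$ and let ${\rm adj}(L)=(L_{i,j})$ be the adjoint matrix of $L$. Suppose $L\mathbf{b}^\top=0$ for some vector $\mathbf{b}$ of $s$ positive integers. The following hold. (a) If ${\rm rank}(\ell_1,\ldots,\widehat{\ell_i},\ldots,\ell_s)=s-1$ and $L_{i,i}\geq 0$ for all $i$, then $\mathbf{c}L=0$ for some vector $\mathbf{c}$ of $s$ positive integers. (b) If $L_{i,i}>0$ for all $i$, then $\mathbf{c}L=0$ for some vector $\mathbf{c}$ of $s$ positive integers. (c) If $L$ is a GCB matrix and ${\rm rank}(\ell_1,\ldots,\widehat{\ell_i},\ldots,\ell_s)=s-1$ for all $i$, then $L^\top$ is a GCB matrix. (d) If $L$ is a GPCB matrix, then ${\rm rank}(L)=s-1$ and $L^\top$ is a GPCB matrix. (e) If $s=3$ and $L$ is a GCB matrix, then ${\rm rank}(L)=2$ and $L^\top$ is a GCB matrix.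
   Context: The adjoint matrix is the classical adjugate: $L_{i,j}=(-1)^{i+j}h_{j,i}$ where $h_{j,i}$ is the determinant of the matrix obtained from $L$ by deleting row $j$ and column $i$. $\widehat{\ell_i}$ means $\ell_i$ is omitted. Consider $s\times s$ integer matrices $L$ with diagonal entries $a_{i,i}$ and off-diagonal entries $-a_{i,j}$ ($i\ne j$), where all $a_{i,j}\in\mathbb{N}=\{0,1,\ldots\}$. Such an $L$ is a GCB (generalized critical binomial) matrix if $a_{j,j}>0$ for all $j$, each column of $L$ has at least one non-zero off-diagonal entry, and there exists a vector $\mathbf{b}$ of $s$ positive integers such that $L\mathbf{b}^\top=0$. It is a GPCB (generalized positive critical binomial) matrix if all entries of $L$ are non-zero and there exists a vector $\mathbf{b}$ of $s$ positive integers such that $L\mathbf{b}^\top=0$. *)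

theory Defs
  imports "Jordan_Normal_Form.DL_Rank"
begin

text \<open>
  Indices run over 0, ..., s - 1 instead of 1, ..., s; the signs in the adjugate
  \<^const>\<open>adj_mat\<close> depend only on the parity of i + j and are unaffected by the shift.
\<close>

definition pos_vec :: "nat \<Rightarrow> int vec \<Rightarrow> bool" where
  "pos_vec s b \<longleftrightarrow> b \<in> carrier_vec s \<and> (\<forall>i<s. 0 < b $ i)"

definition has_pos_right_null :: "nat \<Rightarrow> int mat \<Rightarrow> bool" where
  "has_pos_right_null s L \<longleftrightarrow> (\<exists>b. pos_vec s b \<and> L *\<^sub>v b = 0\<^sub>v s)"

text \<open>The product of a row vector c with L is written as the transpose of L applied to c.\<close>

definition has_pos_left_null :: "nat \<Rightarrow> int mat \<Rightarrow> bool" where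
  "has_pos_left_null s L \<longleftrightarrow> (\<exists>c. pos_vec s c \<and> transpose_mat L *\<^sub>v c = 0\<^sub>v s)"

text \<open>The library's rank is defined over a field, so integer matrices are read over the rationals.\<close>

definition int_rank :: "int mat \<Rightarrow> nat" where
  "int_rank A = vec_space.rank (dim_row A) (map_mat rat_of_int A)"

definition omit_row :: "int mat \<Rightarrow> nat \<Rightarrow> int mat" where
  "omit_row L i =
     mat_of_rows (dim_col L) (map (row L) (filter (\<lambda>k. k \<noteq> i) [0..<dim_row L]))"

text \<open>
  Matrices with diagonal entries a(i,i) and off-diagonal entries -a(i,j), where all
  a(i,j) are natural numbers (possibly 0).
\<close>

definition binomial_sign_pattern :: "nat \<Rightarrow> int mat \<Rightarrow> bool" where
  "binomial_sign_pattern s L \<longleftrightarrow>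
     L \<in> carrier_mat s s \<and>
     (\<forall>i<s. 0 \<le> L $$ (i, i)) \<and>
     (\<forall>i<s. \<forall>j<s. i \<noteq> j \<longrightarrow> L $$ (i, j) \<le> 0)"

definition GCB :: "nat \<Rightarrow> int mat \<Rightarrow> bool" where
  "GCB s L \<longleftrightarrow>
     binomial_sign_pattern s L \<and>
     (\<forall>j<s. 0 < L $$ (j, j)) \<and>
     (\<forall>j<s. \<exists>i<s. i \<noteq> j \<and> L $$ (i, j) \<noteq> 0) \<and>
     has_pos_right_null s L"

definition GPCB :: "nat \<Rightarrow> int mat \<Rightarrow> bool" where
  "GPCB s L \<longleftrightarrow>
     binomial_sign_pattern s L \<and>
     (\<forall>i<s. \<forall>j<s. L $$ (i, j) \<noteq> 0) \<and>
     has_pos_right_null s L"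

end

(* Let N arise from L by replacing row i with a vector u. Column i of adj(N) is that of adj(L), and
   N b = (u . b) e_i, so multiplying by adj(N) gives (u . b) adj(L)_{k,i} = det(N) b_k. Hence every
   column of adj(L) is a multiple of b. If all diagonal entries of adj(L) are positive, then so
   are all its entries, and any row of adj(L) is a positive left null vector: this is (b). In (a),
   a vanishing diagonal entry would force det(N) = 0 for u = b, hence a dependency among the rows
   other than i.

   For (c)-(e): if d L = 0 and L has the binomial sign pattern, then |d| L <= 0 entrywise, while
   |d| L b = 0 with b positive, so |d| L = 0. It remains to see that a non-zero left
   null vector has no zero entry; this also gives rank s - 1. *)

theory Submission
  imports Defs
begin

section \<open>Left null vectors and full row rank\<close>

lemma mult_mat_vec_eq_0_iff:
  assumes "A \<in> carrier_mat m n" "v \<in> carrier_vec n"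
  shows "A *\<^sub>v v = 0\<^sub>v m \<longleftrightarrow> (\<forall>i<m. (\<Sum>j<n. A $$ (i, j) * v $ j) = 0)"
proof -
  have "(A *\<^sub>v v) $ i = (\<Sum>j<n. A $$ (i, j) * v $ j)" if "i < m" for i
    using assms that by (auto simp: scalar_prod_def lessThan_atLeast0 intro!: sum.cong)
  moreover have "dim_vec (A *\<^sub>v v) = m"
    using assms by auto
  ultimately show ?thesis
    by (auto simp: vec_eq_iff)
qed

lemma transpose_mult_mat_vec_eq_0_iff:
  assumes "A \<in> carrier_mat m n" "v \<in> carrier_vec m"
  shows "transpose_mat A *\<^sub>v v = 0\<^sub>v n \<longleftrightarrow> (\<forall>j<n. (\<Sum>i<m. A $$ (i, j) * v $ i) = 0)"
  using assms by (subst mult_mat_vec_eq_0_iff[of _ n m]) (auto intro!: sum.cong)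

text \<open>A maximal independent set of columns has \<open>rank A = n\<close> elements, so these
  columns form an invertible \<open>n\<close> by \<open>n\<close> matrix \<open>M\<close>. A vector
  orthogonal to all columns of \<open>A\<close> is orthogonal to those of \<open>M\<close>, hence
  zero.\<close>

lemma (in vec_space) full_row_rank_left_null:
  assumes A: "A \<in> carrier_mat n nc" and "rank A = n"
    and d: "d \<in> carrier_vec n" and null: "transpose_mat A *\<^sub>v d = 0\<^sub>v nc"
  shows "d = 0\<^sub>v n"
proof -
  \<comment> \<open>The empty set is the independent set that is enlarged to a maximal one.\<close>
  have "lin_indpt {}"
    by (simp add: lin_dep_def)
  then obtain S where "finite S" and S: "maximal S (\<lambda>T. T \<subseteq> set (cols A) \<and> lin_indpt T)"
    using maximal_exists_superset[of "set (cols A)" "\<lambda>T. T \<subseteq> set (cols A) \<and> lin_indpt T" "{}"]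
    by auto
  then have S': "S \<subseteq> set (cols A)" "lin_indpt S" "card S = n"
    using rank_card_indpt[OF A S] \<open>rank A = n\<close> by (auto simp: maximal_def)
  obtain xs where xs: "set xs = S" "distinct xs"
    using \<open>finite S\<close> finite_distinct_list by blast
  then have len: "length xs = n"
    using S'(3) distinct_card by fastforce
  have "S \<subseteq> carrier_vec n"
    using S'(1) cols_dim[of A] A by auto
  define M where "M = mat_of_cols n xs"
  have M: "M \<in> carrier_mat n n"
    unfolding M_def using len by auto
  have cols: "cols M = xs"
    unfolding M_def using \<open>S \<subseteq> carrier_vec n\<close> xs by (intro cols_mat_of_cols) auto
  have "det M \<noteq> 0"
    using lin_indpt_full_rank[OF M] det_rank_iff[OF M] cols xs S'(2) by auto
  then have detT: "det (transpose_mat M) \<noteq> 0"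
    using det_transpose[OF M] by simp
  have "transpose_mat M *\<^sub>v d = 0\<^sub>v n"
  proof (rule eq_vecI)
    fix k assume "k < dim_vec (0\<^sub>v n :: 'a vec)"
    then have k: "k < n" by simp
    then have "xs ! k \<in> set (cols A)"
      using xs S'(1) len by (metis nth_mem subsetD)
    then obtain j where j: "j < nc" "xs ! k = col A j"
      using A by (auto simp: cols_def)
    have "(transpose_mat M *\<^sub>v d) $ k = col M k \<bullet> d"
      using M k by simp
    also have "col M k = col A j"
      using cols M k j len by (metis carrier_matD(2) cols_nth)
    also have "col A j \<bullet> d = (transpose_mat A *\<^sub>v d) $ j"
      using A j by simp
    finally show "(transpose_mat M *\<^sub>v d) $ k = 0\<^sub>v n $ k"
      using null j k by simp
  qed (use M in auto)
  then show ?thesis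
    using detT det_0_iff_vec_prod_zero_field[of "transpose_mat M" n] M d by auto
qed

text \<open>Since \<open>d $ i = 0\<close>, deleting that entry leaves a left null vector of
  \<open>omit_row L i\<close>, whose s - 1 rows are independent over the rationals; so the other
  entries vanish too. In this form, as injectivity of the restricted left kernel, the rank
  hypothesis enters (a) and (c).\<close>

lemma omit_row_full_rank_left_null:
  assumes L: "L \<in> carrier_mat s s" and i: "i < s"
    and rank: "int_rank (omit_row L i) = s - 1"
    and d: "d \<in> carrier_vec s" "transpose_mat L *\<^sub>v d = 0\<^sub>v s" "d $ i = 0"
  shows "d = 0\<^sub>v s"
proof -
  \<comment> \<open>\<open>xs ! k\<close> is the index in \<open>L\<close> of the row that becomes
    row \<open>k\<close> of \<open>omit_row L i\<close>.\<close>
  define xs where "xs = filter (\<lambda>k. k \<noteq> i) [0..<s]"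
  have xs: "distinct xs" "set xs = {..<s} - {i}"
    unfolding xs_def by auto
  then have len: "length xs = s - 1"
    using i distinct_card[of xs] by simp
  have omit: "omit_row L i = mat_of_rows s (map (row L) xs)"
    unfolding omit_row_def xs_def using L by simp
  then have O: "omit_row L i \<in> carrier_mat (s - 1) s"
    using len by (simp add: mat_of_rows_def)
  have xs_less: "xs ! k < s" if "k < s - 1" for k
    using that xs len nth_mem by fastforce
  have entry: "omit_row L i $$ (k, j) = L $$ (xs ! k, j)" if "k < s - 1" "j < s" for k j
    unfolding omit using that len L xs_less[OF that(1)] by (simp add: mat_of_rows_def)
  define A where "A = map_mat rat_of_int (omit_row L i)"
  have A: "A \<in> carrier_mat (s - 1) s"
    unfolding A_def using O by simp
  define v where "v = vec (s - 1) (\<lambda>k. rat_of_int (d $ (xs ! k)))"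
  have v: "v \<in> carrier_vec (s - 1)"
    unfolding v_def by simp
  have "transpose_mat A *\<^sub>v v = 0\<^sub>v s"
    unfolding transpose_mult_mat_vec_eq_0_iff[OF A v]
  proof (intro allI impI)
    fix j assume j: "j < s"
    have "(\<Sum>k<s - 1. A $$ (k, j) * v $ k) = (\<Sum>k<s - 1. rat_of_int (L $$ (xs ! k, j) * d $ (xs ! k)))"
      using j O by (intro sum.cong) (auto simp: A_def v_def entry)
    also have "\<dots> = (\<Sum>k\<in>{..<s} - {i}. rat_of_int (L $$ (k, j) * d $ k))"
      using sum.reindex_bij_betw[OF bij_betw_nth[OF xs(1) refl refl],
          of "\<lambda>k. rat_of_int (L $$ (k, j) * d $ k)"] xs(2) len by simp
    also have "\<dots> = (\<Sum>k<s. rat_of_int (L $$ (k, j) * d $ k))"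
      by (intro sum.mono_neutral_left) (use d(3) in auto)
    also have "\<dots> = rat_of_int (\<Sum>k<s. L $$ (k, j) * d $ k)"
      by simp
    also have "\<dots> = 0"
      using d(2) transpose_mult_mat_vec_eq_0_iff[OF L d(1)] j by simp
    finally show "(\<Sum>k<s - 1. A $$ (k, j) * v $ k) = 0" .
  qed
  \<comment> \<open>\<open>int_rank\<close> takes the number of rows as the dimension of the ambient
    space, here s - 1.\<close>
  moreover have "vec_space.rank (s - 1) A = s - 1"
    using rank O unfolding int_rank_def A_def by simp
  ultimately have "v = 0\<^sub>v (s - 1)"
    using vec_space.full_row_rank_left_null[OF A _ v] by blast
  then have "d $ (xs ! k) = 0" if "k < s - 1" for k
    using that unfolding v_def by (auto simp: vec_eq_iff)
  then have "d $ k = 0" if "k < s" for k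
    using that d(3) xs(2) len by (metis Diff_iff in_set_conv_nth lessThan_iff singletonD)
  then show ?thesis
    using d(1) by auto
qed

section \<open>Row replacement and the adjugate\<close>

definition replace_row :: "'a mat \<Rightarrow> nat \<Rightarrow> 'a vec \<Rightarrow> 'a mat" where
  "replace_row A i u =
     mat (dim_row A) (dim_col A) (\<lambda>(k, j). if k = i then u $ j else A $$ (k, j))"

lemma replace_row_carrier [simp]: "A \<in> carrier_mat m n \<Longrightarrow> replace_row A i u \<in> carrier_mat m n"
  by (simp add: replace_row_def)

text \<open>Column \<open>i\<close> of the adjugate consists of the cofactors along row
  \<open>i\<close>, and their minors all delete that row.\<close>

lemma adj_mat_replace_row:
  assumes "A \<in> carrier_mat n n" "i < n" "k < n"
  shows "adj_mat (replace_row A i u) $$ (k, i) = adj_mat A $$ (k, i)"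
proof -
  have "mat_delete (replace_row A i u) i k = mat_delete A i k"
    using assms by (intro eq_matI) (auto simp: mat_delete_def replace_row_def)
  then show ?thesis
    using assms by (simp add: adj_mat_def cofactor_def replace_row_def)
qed

text \<open>Laplace expansion along row \<open>i\<close>, whose cofactors do not see
  \<open>u\<close>. Unit vectors \<open>u\<close> pick out single adjugate entries; the choice of a
  null vector \<open>b\<close> for \<open>u\<close> later shows that a column of the adjugate is
  non-zero.\<close>

lemma det_replace_row:
  fixes A :: "'a :: comm_ring_1 mat"
  assumes A: "A \<in> carrier_mat n n" and i: "i < n"
  shows "det (replace_row A i u) = (\<Sum>j<n. u $ j * adj_mat A $$ (j, i))"
proof -
  let ?N = "replace_row A i u"
  have "det ?N = (\<Sum>j<n. ?N $$ (i, j) * cofactor ?N i j)"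
    using A i by (intro laplace_expansion_row) auto
  also have "\<dots> = (\<Sum>j<n. u $ j * adj_mat ?N $$ (j, i))"
    using A i by (intro sum.cong) (auto simp: replace_row_def adj_mat_def)
  also have "\<dots> = (\<Sum>j<n. u $ j * adj_mat A $$ (j, i))"
    using A i by (intro sum.cong) (auto simp: adj_mat_replace_row)
  finally show ?thesis .
qed

lemma adj_mat_col_proportional:
  fixes A :: "'a :: comm_ring_1 mat"
  assumes A: "A \<in> carrier_mat n n" and b: "b \<in> carrier_vec n" and null: "A *\<^sub>v b = 0\<^sub>v n"
    and i: "i < n" and k: "k < n" and l: "l < n"
  shows "adj_mat A $$ (k, i) * b $ l = adj_mat A $$ (l, i) * b $ k"
proof -
  define N where "N = replace_row A i (unit_vec n l)"
  have N: "N \<in> carrier_mat n n"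
    unfolding N_def using A by simp
  have "det N = (\<Sum>j<n. unit_vec n l $ j * adj_mat A $$ (j, i))"
    unfolding N_def by (rule det_replace_row[OF A i])
  also have "\<dots> = (\<Sum>j<n. if j = l then adj_mat A $$ (j, i) else 0)"
    using l by (intro sum.cong) (auto simp: unit_vec_def)
  finally have det: "det N = adj_mat A $$ (l, i)"
    using l by simp
  have Nb: "N *\<^sub>v b = b $ l \<cdot>\<^sub>v unit_vec n i"
  proof (rule eq_vecI)
    fix j assume "j < dim_vec (b $ l \<cdot>\<^sub>v unit_vec n i)"
    then have j: "j < n" by simp
    show "(N *\<^sub>v b) $ j = (b $ l \<cdot>\<^sub>v unit_vec n i) $ j"
    proof (cases "j = i")
      case True
      then have "row N j = unit_vec n l"
        using A j by (auto simp: N_def replace_row_def)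
      then show ?thesis
        using True N b j l by simp
    next
      case False
      then have "row N j = row A j"
        using A j by (auto simp: N_def replace_row_def)
      then have "(N *\<^sub>v b) $ j = (A *\<^sub>v b) $ j"
        using N A j by simp
      then show ?thesis
        using False null i j by simp
    qed
  qed (use N in auto)
  \<comment> \<open>Coordinate \<open>k\<close> of adj(N) N b is evaluated in two ways: through
    adj(N) N = det(N) 1 and through \<open>Nb\<close>.\<close>
  have "det N * b $ k = ((det N \<cdot>\<^sub>m 1\<^sub>m n) *\<^sub>v b) $ k"
    using b k by (simp add: scalar_prod_def if_distrib if_distribR sum.If_cases)
  also have "\<dots> = (adj_mat N *\<^sub>v (N *\<^sub>v b)) $ k"
    using adj_mat[OF N] N b by (metis assoc_mult_mat_vec)
  also have "\<dots> = b $ l * adj_mat N $$ (k, i)"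
    using adj_mat(1)[OF N] i k unfolding Nb by (simp add: mult_mat_vec)
  finally show ?thesis
    using adj_mat_replace_row[OF A i k] det by (simp add: N_def mult.commute)
qed

text \<open>Let d N = 0 for the modified matrix N. Every row of N except row \<open>i\<close> kills
  \<open>b\<close>, and row \<open>i\<close> gives b . b > 0, so d N b = 0 forces
  \<open>d $ i = 0\<close>. Then the replaced row does not contribute to d N, so d L = 0, and
  \<open>inj\<close> yields d = 0.\<close>

lemma det_replace_row_null_vec:
  assumes L: "L \<in> carrier_mat s s" and i: "i < s"
    and b: "pos_vec s b" "L *\<^sub>v b = 0\<^sub>v s"
    and inj: "\<And>d. \<lbrakk>d \<in> carrier_vec s; transpose_mat L *\<^sub>v d = 0\<^sub>v s; d $ i = 0\<rbrakk> \<Longrightarrow> d = 0\<^sub>v s"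
  shows "det (replace_row L i b) \<noteq> 0"
proof
  let ?N = "replace_row L i b"
  have bc: "b \<in> carrier_vec s"
    using b by (simp add: pos_vec_def)
  have N: "?N \<in> carrier_mat s s"
    using L by simp
  assume "det ?N = 0"
  then have "det (transpose_mat ?N) = 0"
    using det_transpose[OF N] by simp
  then obtain d where d: "d \<in> carrier_vec s" "d \<noteq> 0\<^sub>v s" "transpose_mat ?N *\<^sub>v d = 0\<^sub>v s"
    using det_0_iff_vec_prod_zero[of "transpose_mat ?N" s] N by auto
  have cols: "(\<Sum>k<s. ?N $$ (k, j) * d $ k) = 0" if "j < s" for j
    using transpose_mult_mat_vec_eq_0_iff[OF N d(1)] d(3) that by blast
  have rows: "(\<Sum>j<s. L $$ (k, j) * b $ j) = 0" if "k < s" for k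
    using mult_mat_vec_eq_0_iff[OF L bc] b(2) that by blast
  have rowN: "(\<Sum>j<s. ?N $$ (k, j) * b $ j) = (if k = i then \<Sum>j<s. b $ j * b $ j else 0)"
    if "k < s" for k
    using that L rows[OF that] by (auto simp: replace_row_def)
  \<comment> \<open>The scalar d N b, with the order of summation exchanged.\<close>
  have "0 = (\<Sum>j<s. (\<Sum>k<s. ?N $$ (k, j) * d $ k) * b $ j)"
    using cols by simp
  also have "\<dots> = (\<Sum>k<s. (\<Sum>j<s. ?N $$ (k, j) * b $ j) * d $ k)"
    by (simp add: sum_distrib_left sum_distrib_right mult_ac) (rule sum.swap)
  also have "\<dots> = (\<Sum>k<s. if k = i then (\<Sum>j<s. b $ j * b $ j) * d $ k else 0)"
    using rowN by (intro sum.cong) auto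
  also have "\<dots> = (\<Sum>j<s. b $ j * b $ j) * d $ i"
    using i by simp
  finally have "(\<Sum>j<s. b $ j * b $ j) * d $ i = 0"
    by simp
  moreover have "(\<Sum>j<s. b $ j * b $ j) > 0"
    using b i by (intro sum_pos) (auto simp: pos_vec_def)
  ultimately have di: "d $ i = 0"
    by simp
  have "(\<Sum>k<s. L $$ (k, j) * d $ k) = (\<Sum>k<s. ?N $$ (k, j) * d $ k)" if "j < s" for j
    using that L di by (intro sum.cong) (auto simp: replace_row_def)
  then have "transpose_mat L *\<^sub>v d = 0\<^sub>v s"
    using transpose_mult_mat_vec_eq_0_iff[OF L d(1)] cols by simp
  then show False
    using inj[OF d(1)] di d(2) by blast
qed

section \<open>Consequences of a positive right null vector\<close>

lemma det_eq_0_if_pos_right_null: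
  assumes "L \<in> carrier_mat s s" "1 \<le> s" "pos_vec s b" "L *\<^sub>v b = 0\<^sub>v s"
  shows "det L = 0"
proof -
  have "b \<noteq> 0\<^sub>v s"
    using assms(2,3) by (auto simp: pos_vec_def dest: spec[of _ 0])
  then show ?thesis
    using assms det_0_iff_vec_prod_zero[of L s] by (auto simp: pos_vec_def)
qed

text \<open>Each column of adj(L) is proportional to the positive vector \<open>b\<close> and has a
  positive diagonal entry, so it is positive throughout. Rows of adj(L) are left null vectors
  because adj(L) L = det(L) 1 = 0.\<close>

lemma has_pos_left_null_if_adj_diag_pos:
  assumes L: "L \<in> carrier_mat s s" and s: "1 \<le> s"
    and b: "pos_vec s b" "L *\<^sub>v b = 0\<^sub>v s"
    and diag: "\<forall>i<s. 0 < adj_mat L $$ (i, i)"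
  shows "has_pos_left_null s L"
proof -
  \<comment> \<open>Any row would do; row 0 exists since \<open>s\<close> is at least 1.\<close>
  define c where "c = row (adj_mat L) 0"
  have adj: "adj_mat L \<in> carrier_mat s s"
    using adj_mat(1)[OF L] .
  have c: "c \<in> carrier_vec s" "\<And>j. j < s \<Longrightarrow> c $ j = adj_mat L $$ (0, j)"
    unfolding c_def using adj s by auto
  have "0 < c $ j" if "j < s" for j
  proof -
    have "adj_mat L $$ (0, j) * b $ j = adj_mat L $$ (j, j) * b $ 0"
      using adj_mat_col_proportional[OF L _ b(2)] b(1) that s by (simp add: pos_vec_def)
    moreover have "0 < adj_mat L $$ (j, j) * b $ 0" "0 < b $ j"
      using diag b(1) that s by (auto simp: pos_vec_def)
    ultimately show ?thesis
      using c(2)[OF that] by (metis zero_less_mult_pos2)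
  qed
  moreover have "transpose_mat L *\<^sub>v c = 0\<^sub>v s"
  proof (rule eq_vecI)
    fix j assume "j < dim_vec (0\<^sub>v s :: int vec)"
    then have j: "j < s" by simp
    have "(transpose_mat L *\<^sub>v c) $ j = (adj_mat L * L) $$ (0, j)"
      using j s L adj c(1) unfolding c_def
      by (simp add: comm_scalar_prod[of _ s])
    also have "\<dots> = 0"
      using adj_mat(3)[OF L] det_eq_0_if_pos_right_null[OF L s b] j s by simp
    finally show "(transpose_mat L *\<^sub>v c) $ j = 0\<^sub>v s $ j"
      using j by simp
  qed (use L in auto)
  ultimately show ?thesis
    using c(1) by (auto simp: has_pos_left_null_def pos_vec_def)
qed

text \<open>As \<open>b $ i\<close> is positive, proportionality to \<open>b\<close> spreads a zero
  at \<open>(i, i)\<close> over all of column \<open>i\<close>. The determinant with row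
  \<open>i\<close> replaced by \<open>b\<close> pairs \<open>b\<close> with this column, so it would
  vanish.\<close>

lemma adj_diag_nonzero:
  assumes L: "L \<in> carrier_mat s s" and i: "i < s"
    and b: "pos_vec s b" "L *\<^sub>v b = 0\<^sub>v s"
    and inj: "\<And>d. \<lbrakk>d \<in> carrier_vec s; transpose_mat L *\<^sub>v d = 0\<^sub>v s; d $ i = 0\<rbrakk> \<Longrightarrow> d = 0\<^sub>v s"
  shows "adj_mat L $$ (i, i) \<noteq> 0"
proof
  assume "adj_mat L $$ (i, i) = 0"
  then have "adj_mat L $$ (k, i) = 0" if "k < s" for k
    using adj_mat_col_proportional[OF L _ b(2) i that i] b(1) i by (auto simp: pos_vec_def)
  then have "det (replace_row L i b) = 0"
    using det_replace_row[OF L i] by simp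
  then show False
    using det_replace_row_null_vec[OF L i b inj] by blast
qed

text \<open>The rank is below \<open>s\<close> because det(L) = 0. Replacing row 0 by
  \<open>b\<close> gives an invertible matrix and changes the rank by at most 1, so the rank is at
  least s - 1.\<close>

lemma int_rank_eq_pred:
  assumes L: "L \<in> carrier_mat s s" and s: "1 \<le> s"
    and b: "pos_vec s b" "L *\<^sub>v b = 0\<^sub>v s"
    and inj: "\<And>d. \<lbrakk>d \<in> carrier_vec s; transpose_mat L *\<^sub>v d = 0\<^sub>v s; d $ 0 = 0\<rbrakk> \<Longrightarrow> d = 0\<^sub>v s"
  shows "int_rank L = s - 1"
proof -
  define A where "A = map_mat rat_of_int L"
  define N where "N = map_mat rat_of_int (replace_row L 0 b)"
  define E where "E = N - A"
  have car: "A \<in> carrier_mat s s" "N \<in> carrier_mat s s" "E \<in> carrier_mat s s"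
    unfolding E_def A_def N_def using L by auto
  have "det A = 0"
    unfolding A_def of_int_hom.hom_det using det_eq_0_if_pos_right_null[OF L s b] by simp
  then have less: "vec_space.rank s A < s"
    by (rule vec_space.det_zero_low_rank[OF car(1)])
  have "det (replace_row L 0 b) \<noteq> 0"
    using det_replace_row_null_vec[OF L _ b inj] s by simp
  then have "vec_space.rank s N = s"
    using vec_space.low_rank_det_zero[OF car(2)] unfolding N_def of_int_hom.hom_det by simp
  moreover have "N = A + E"
    unfolding E_def A_def N_def using L by (intro eq_matI) (auto simp: replace_row_def)
  \<comment> \<open>\<open>E\<close> is supported in row 0: it is the outer product of the unit
    vector at 0 with \<open>b\<close> minus row 0 of \<open>L\<close>.\<close>
  moreover have "vec_space.rank s E \<le> 1"
    by (rule vec_space.rank_le_1_product_entries[OF car(3),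
          where f = "\<lambda>r. if r = 0 then 1 else 0" and g = "\<lambda>c. rat_of_int (b $ c - L $$ (0, c))"])
      (use L in \<open>auto simp: E_def A_def N_def replace_row_def split: if_splits\<close>)
  ultimately have "s \<le> vec_space.rank s A + 1"
    using vec_space.rank_subadditive[OF car(1,3)] by simp
  then show ?thesis
    using less L unfolding int_rank_def A_def by simp
qed

section \<open>Left null vectors under the binomial sign pattern\<close>

lemma abs_left_null:
  assumes pat: "binomial_sign_pattern s L" and b: "pos_vec s b" "L *\<^sub>v b = 0\<^sub>v s"
    and d: "d \<in> carrier_vec s" "transpose_mat L *\<^sub>v d = 0\<^sub>v s"
    and j: "j < s"
  shows "(\<Sum>i<s. L $$ (i, j) * \<bar>d $ i\<bar>) = 0"
proof -
  have L: "L \<in> carrier_mat s s" and bc: "b \<in> carrier_vec s"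
    using pat b by (auto simp: binomial_sign_pattern_def pos_vec_def)
  define q where "q j = (\<Sum>i<s. L $$ (i, j) * \<bar>d $ i\<bar>)" for j
  \<comment> \<open>triangle inequality in \<open>L\<^sub>j\<^sub>j d\<^sub>j = \<Sum>i\<noteq>j. - L\<^sub>i\<^sub>j d\<^sub>i\<close>, where all \<open>- L\<^sub>i\<^sub>j\<close> are non-negative\<close>
  have nonpos: "q j \<le> 0" if j: "j < s" for j
  proof -
    have split: "(\<Sum>i<s. L $$ (i, j) * f i) = L $$ (j, j) * f j + (\<Sum>i\<in>{..<s} - {j}. L $$ (i, j) * f i)"
      for f :: "nat \<Rightarrow> int"
      using j by (subst sum.remove[of _ j]) auto
    have "L $$ (j, j) * d $ j = - (\<Sum>i\<in>{..<s} - {j}. L $$ (i, j) * d $ i)"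
      using transpose_mult_mat_vec_eq_0_iff[OF L d(1)] d(2) j split[of "\<lambda>i. d $ i"] by simp
    then have "\<bar>L $$ (j, j) * d $ j\<bar> = \<bar>\<Sum>i\<in>{..<s} - {j}. L $$ (i, j) * d $ i\<bar>"
      by (simp only: abs_minus_cancel)
    also have "\<dots> \<le> (\<Sum>i\<in>{..<s} - {j}. \<bar>L $$ (i, j) * d $ i\<bar>)"
      by (rule sum_abs)
    also have "\<dots> = - (\<Sum>i\<in>{..<s} - {j}. L $$ (i, j) * \<bar>d $ i\<bar>)"
      unfolding sum_negf[symmetric] using pat j
      by (intro sum.cong) (auto simp: abs_mult binomial_sign_pattern_def)
    also have "\<bar>L $$ (j, j) * d $ j\<bar> = L $$ (j, j) * \<bar>d $ j\<bar>"
      using pat j by (auto simp: abs_mult binomial_sign_pattern_def)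
    finally show ?thesis
      unfolding q_def split[of "\<lambda>i. \<bar>d $ i\<bar>"] by simp
  qed
  \<comment> \<open>Both sides are |d| L b. Since all \<open>q j\<close> are at most 0 and all
    \<open>b $ j\<close> are positive, a zero total forces every \<open>q j\<close> to vanish; the
    sign is flipped below to get a sum of non-negative terms.\<close>
  have "(\<Sum>j<s. q j * b $ j) = (\<Sum>i<s. (\<Sum>j<s. L $$ (i, j) * b $ j) * \<bar>d $ i\<bar>)"
    unfolding q_def by (simp add: sum_distrib_left sum_distrib_right mult_ac) (rule sum.swap)
  also have "\<dots> = 0"
    using mult_mat_vec_eq_0_iff[OF L bc] b(2) by simp
  finally have "(\<Sum>j<s. - (q j * b $ j)) = 0"
    by (simp add: sum_negf)
  then have "\<forall>j\<in>{..<s}. - (q j * b $ j) = 0"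
    using nonpos b(1) by (subst (asm) sum_nonneg_eq_0_iff) (auto simp: pos_vec_def mult_le_0_iff)
  then show ?thesis
    using j b(1) unfolding q_def by (fastforce simp: pos_vec_def)
qed

text \<open>In column \<open>j\<close> of |d| L = 0 the diagonal term drops out when
  \<open>d $ j = 0\<close>; the remaining terms are all at most 0, so each one vanishes. Thus a zero
  of \<open>d\<close> at \<open>j\<close> spreads to every \<open>i\<close> with
  \<open>L $$ (i, j)\<close> non-zero.\<close>

lemma left_null_zero_entry:
  assumes pat: "binomial_sign_pattern s L" and b: "pos_vec s b" "L *\<^sub>v b = 0\<^sub>v s"
    and d: "d \<in> carrier_vec s" "transpose_mat L *\<^sub>v d = 0\<^sub>v s"
    and "j < s" "d $ j = 0" "i < s"
  shows "L $$ (i, j) * d $ i = 0"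
proof -
  have "(\<Sum>i<s. - (L $$ (i, j) * \<bar>d $ i\<bar>)) = 0"
    using abs_left_null[OF pat b d \<open>j < s\<close>] by (simp add: sum_negf)
  moreover have "0 \<le> - (L $$ (i, j) * \<bar>d $ i\<bar>)" if "i < s" for i
    using pat that \<open>j < s\<close> \<open>d $ j = 0\<close>
    by (cases "i = j") (auto simp: binomial_sign_pattern_def mult_le_0_iff)
  ultimately have "\<forall>i\<in>{..<s}. - (L $$ (i, j) * \<bar>d $ i\<bar>) = 0"
    by (subst (asm) sum_nonneg_eq_0_iff) auto
  then show ?thesis
    using \<open>i < s\<close> by auto
qed

text \<open>As det(L) = 0, there is a non-zero integer left null vector \<open>d\<close>. Its
  entrywise absolute value is again a left null vector, and \<open>inj\<close> excludes zero
  entries.\<close>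

lemma has_pos_left_null_if_no_zero_entry:
  assumes s: "1 \<le> s" and pat: "binomial_sign_pattern s L" and b: "pos_vec s b" "L *\<^sub>v b = 0\<^sub>v s"
    and inj: "\<And>d i. \<lbrakk>i < s; d \<in> carrier_vec s; transpose_mat L *\<^sub>v d = 0\<^sub>v s; d $ i = 0\<rbrakk> \<Longrightarrow> d = 0\<^sub>v s"
  shows "has_pos_left_null s L"
proof -
  have L: "L \<in> carrier_mat s s"
    using pat by (simp add: binomial_sign_pattern_def)
  have "det (transpose_mat L) = 0"
    using det_transpose[OF L] det_eq_0_if_pos_right_null[OF L s b] by simp
  then obtain d where d: "d \<in> carrier_vec s" "d \<noteq> 0\<^sub>v s" "transpose_mat L *\<^sub>v d = 0\<^sub>v s"
    using det_0_iff_vec_prod_zero[of "transpose_mat L" s] L by auto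
  define c where "c = vec s (\<lambda>i. \<bar>d $ i\<bar>)"
  have c: "c \<in> carrier_vec s"
    unfolding c_def by simp
  have "pos_vec s c"
    using inj[OF _ d(1) d(3)] d(2) unfolding c_def pos_vec_def by auto
  moreover have "transpose_mat L *\<^sub>v c = 0\<^sub>v s"
    unfolding transpose_mult_mat_vec_eq_0_iff[OF L c]
    using abs_left_null[OF pat b d(1,3)] by (simp add: c_def)
  ultimately show ?thesis
    unfolding has_pos_left_null_def by blast
qed

section \<open>Transposes and left kernels of GCB and GPCB matrices\<close>

lemma GCB_transpose:
  assumes G: "GCB s L" and left: "has_pos_left_null s L"
  shows "GCB s (transpose_mat L)"
proof -
  have L: "L \<in> carrier_mat s s"
    using G by (simp add: GCB_def binomial_sign_pattern_def)
  obtain b where b: "pos_vec s b" "L *\<^sub>v b = 0\<^sub>v s"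
    using G by (auto simp: GCB_def has_pos_right_null_def)
  \<comment> \<open>If row \<open>j\<close> had only its diagonal entry, row \<open>j\<close> of L b
    = 0 would say that the product of two positive numbers, \<open>L $$ (j, j)\<close> and
    \<open>b $ j\<close>, is zero.\<close>
  have "\<exists>i<s. i \<noteq> j \<and> L $$ (j, i) \<noteq> 0" if j: "j < s" for j
  proof (rule ccontr)
    assume "\<not> ?thesis"
    then have "(\<Sum>i<s. L $$ (j, i) * b $ i) = (\<Sum>i<s. if i = j then L $$ (j, j) * b $ j else 0)"
      by (intro sum.cong) auto
    moreover have "(\<Sum>i<s. L $$ (j, i) * b $ i) = 0"
      using mult_mat_vec_eq_0_iff[OF L] b j by (auto simp: pos_vec_def)
    ultimately show False
      using G b(1) j by (auto simp: GCB_def pos_vec_def)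
  qed
  then have "\<forall>j<s. \<exists>i<s. i \<noteq> j \<and> transpose_mat L $$ (i, j) \<noteq> 0"
    using L by (metis carrier_matD index_transpose_mat(1))
  then show ?thesis
    using G left L
    by (auto simp: GCB_def binomial_sign_pattern_def has_pos_right_null_def has_pos_left_null_def)
qed

text \<open>All entries in column \<open>j\<close> are non-zero, so a zero of \<open>d\<close> at
  \<open>j\<close> reaches every index at once.\<close>

lemma GPCB_left_null_no_zero_entry:
  assumes G: "GPCB s L"
    and d: "d \<in> carrier_vec s" "transpose_mat L *\<^sub>v d = 0\<^sub>v s" and j: "j < s" "d $ j = 0"
  shows "d = 0\<^sub>v s"
proof -
  obtain b where b: "pos_vec s b" "L *\<^sub>v b = 0\<^sub>v s"
    using G by (auto simp: GPCB_def has_pos_right_null_def)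
  have "d $ i = 0" if "i < s" for i
    using left_null_zero_entry[OF _ b d j that] G j that by (auto simp: GPCB_def)
  then show ?thesis
    using d(1) by auto
qed

text \<open>A non-zero off-diagonal entry in column \<open>j\<close> carries the zero to a second
  index \<open>i\<close>. If \<open>d\<close> were non-zero at the third index \<open>k\<close>, row
  \<open>k\<close> of \<open>L\<close> would have only its diagonal entry, against L b = 0.\<close>

lemma GCB_3_left_null_no_zero_entry:
  assumes G: "GCB 3 L"
    and d: "d \<in> carrier_vec 3" "transpose_mat L *\<^sub>v d = 0\<^sub>v 3" and j: "j < 3" "d $ j = 0"
  shows "d = 0\<^sub>v 3"
proof -
  have pat: "binomial_sign_pattern 3 L" and L: "L \<in> carrier_mat 3 3"
    using G by (auto simp: GCB_def binomial_sign_pattern_def)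
  obtain b where b: "pos_vec 3 b" "L *\<^sub>v b = 0\<^sub>v 3"
    using G by (auto simp: GCB_def has_pos_right_null_def)
  note zero = left_null_zero_entry[OF pat b d]
  obtain i where i: "i < 3" "i \<noteq> j" "L $$ (i, j) \<noteq> 0"
    using G j by (auto simp: GCB_def)
  have di: "d $ i = 0"
    using zero[OF j i(1)] i by simp
  obtain k where k: "k < 3" "k \<noteq> i" "k \<noteq> j" and all: "{..<3} = {i, j, k}"
  proof
    have "i = 0 \<or> i = 1 \<or> i = 2" "j = 0 \<or> j = 1 \<or> j = 2"
      using i(1) j(1) by auto
    \<comment> \<open>The indices 0, 1, 2 add up to 3, so this difference is the third
      index.\<close>
    then show "3 - i - j < 3" "3 - i - j \<noteq> i" "3 - i - j \<noteq> j" "{..<3} = {i, j, 3 - i - j}"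
      using i(2) by auto
  qed
  have "d $ k = 0"
  proof (rule ccontr)
    assume "d $ k \<noteq> 0"
    then have "L $$ (k, j) = 0" "L $$ (k, i) = 0"
      using zero[OF j k(1)] zero[OF i(1) di k(1)] by auto
    moreover have "(\<Sum>l\<in>{i, j, k}. L $$ (k, l) * b $ l) = 0"
      using mult_mat_vec_eq_0_iff[OF L] b k all by (auto simp: pos_vec_def)
    ultimately have "L $$ (k, k) * b $ k = 0"
      using k i by simp
    then show False
      using G b k by (auto simp: GCB_def pos_vec_def)
  qed
  then have "\<forall>l\<in>{..<3}. d $ l = 0"
    unfolding all using di j by simp
  then show ?thesis
    using d(1) by auto
qed

theorem theorem6p3:
  fixes s :: nat and L :: "int mat"
  assumes "1 \<le> s"
    and "L \<in> carrier_mat s s"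
    and "has_pos_right_null s L"
  shows
    "((\<forall>i<s. int_rank (omit_row L i) = s - 1) \<and> (\<forall>i<s. 0 \<le> adj_mat L $$ (i, i))
        \<longrightarrow> has_pos_left_null s L)
     \<and> ((\<forall>i<s. 0 < adj_mat L $$ (i, i)) \<longrightarrow> has_pos_left_null s L)
     \<and> (GCB s L \<and> (\<forall>i<s. int_rank (omit_row L i) = s - 1) \<longrightarrow> GCB s (transpose_mat L))
     \<and> (GPCB s L \<longrightarrow> int_rank L = s - 1 \<and> GPCB s (transpose_mat L))
     \<and> (s = 3 \<and> GCB s L \<longrightarrow> int_rank L = 2 \<and> GCB s (transpose_mat L))"
proof (intro conjI impI; (elim conjE)?)
  note s = assms(1) and L = assms(2)
  obtain b where b: "pos_vec s b" "L *\<^sub>v b = 0\<^sub>v s"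
    using assms(3) by (auto simp: has_pos_right_null_def)
  show pos: "has_pos_left_null s L" if "\<forall>i<s. 0 < adj_mat L $$ (i, i)"
    using has_pos_left_null_if_adj_diag_pos[OF L s b that] .
  show "has_pos_left_null s L"
    if rank: "\<forall>i<s. int_rank (omit_row L i) = s - 1" and "\<forall>i<s. 0 \<le> adj_mat L $$ (i, i)"
  \<comment> \<open>Reduction of (a) to (b): the rank condition excludes zeros on the diagonal of
    the adjugate.\<close>
  proof (rule pos, intro allI impI)
    fix i assume i: "i < s"
    have "adj_mat L $$ (i, i) \<noteq> 0"
      using adj_diag_nonzero[OF L i b] omit_row_full_rank_left_null[OF L i] rank i by blast
    then show "0 < adj_mat L $$ (i, i)"
      using that(2) i by (simp add: order_less_le)
  qed
  show "GCB s (transpose_mat L)"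
    if G: "GCB s L" and rank: "\<forall>i<s. int_rank (omit_row L i) = s - 1"
  proof (rule GCB_transpose[OF G has_pos_left_null_if_no_zero_entry[OF s _ b]])
    show "binomial_sign_pattern s L"
      using G by (simp add: GCB_def)
    show "d = 0\<^sub>v s" if "i < s" "d \<in> carrier_vec s" "transpose_mat L *\<^sub>v d = 0\<^sub>v s" "d $ i = 0" for d i
      using omit_row_full_rank_left_null[OF L that(1) _ that(2-4)] rank that(1) by blast
  qed
  show "int_rank L = s - 1" if "GPCB s L"
    using int_rank_eq_pred[OF L s b] GPCB_left_null_no_zero_entry[OF that] s by auto
  show "GPCB s (transpose_mat L)" if G: "GPCB s L"
  proof -
    have "has_pos_left_null s L"
      using has_pos_left_null_if_no_zero_entry[OF s _ b] GPCB_left_null_no_zero_entry[OF G] G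
      by (auto simp: GPCB_def)
    then show ?thesis
      using G L
      by (auto simp: GPCB_def binomial_sign_pattern_def has_pos_right_null_def has_pos_left_null_def)
  qed
  show "int_rank L = 2" if "s = 3" "GCB s L"
  proof -
    have "int_rank L = s - 1"
      using GCB_3_left_null_no_zero_entry[of L _ 0] that by (intro int_rank_eq_pred[OF L s b]) auto
    then show ?thesis
      using that(1) by simp
  qed
  show "GCB s (transpose_mat L)" if "s = 3" "GCB s L"
  proof (rule GCB_transpose[OF that(2) has_pos_left_null_if_no_zero_entry[OF s _ b]])
    show "binomial_sign_pattern s L"
      using that(2) by (simp add: GCB_def)
    show "d = 0\<^sub>v s" if "i < s" "d \<in> carrier_vec s" "transpose_mat L *\<^sub>v d = 0\<^sub>v s" "d $ i = 0" for d i
      using GCB_3_left_null_no_zero_entry[of L d i] that \<open>GCB s L\<close> unfolding \<open>s = 3\<close> by blast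
  qed
qed

end
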